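(* Let $(G,+)$ be a finite abelian group and let ${\bf F}$ be a field of characteristic zero or of characteristic $p$ not dividing $|G|$. Let ${\bf E}$ be an extension of ${\bf F}$ containing a primitive $N$-th root of unity, where $N={\rm exp}(G)$, and let $\hat G$ be the group of ${\bf E}$-valued characters of $G$. Then for any nonzero function $f:G\to{\bf F}$ with Fourier transform $\hat f$, \[ |{\rm supp}(f)|\,|{\rm supp}(\hat f)|\ \ge\ |G|+|{\rm supp}(\hat f)|-|H({\rm supp}(\hat f))|, \] and dually, \[ |{\rm supp}(f)|\,|{\rm supp}(\hat f)|\ \ge\ |G|+|{\rm supp}(f)|-|H({\rm supp}(f))|. \]
   Context: Characters are group homomorphisms $G\to{\bf E}^*$; $\hat G$ is the group of characters under pointwise multiplication, written additively. The Fourier transform is $\hat f(\chi)=\sum_{x\in G}f(x)\chi(-x)$. ${\rm supp}(f)=\{x\in G:f(x)\ne0\}\subseteq G$ and ${\rm supp}(\hat f)=\{\chi\in\hat G:\hat f(\chi)\ne0\}\subseteq\hat G$. For a subset $S$ of an abelian group $A$, its stabilizer is $H(S)=\{g\in A: g+S=S\}$; thus $H({\rm supp}(\hat f))$ is a subgroup of $\hat G$ and $H({\rm supp}(f))$ is a subgroup of $G$. *)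

theory Defs
  imports Complex_Main "HOL-Computational_Algebra.Computational_Algebra"
begin

typedef (overloaded) ('g::ab_group_add, 'e::field) character =
  "{\<chi> :: 'g \<Rightarrow> 'e. (\<forall>x. \<chi> x \<noteq> 0) \<and> (\<forall>x y. \<chi> (x + y) = \<chi> x * \<chi> y)}"
  morphisms char_eval Character
  by (rule exI[of _ "\<lambda>_. 1"]) simp

setup_lifting type_definition_character

text \<open>The character group carries pointwise multiplication, written additively.\<close>

instantiation character :: (ab_group_add, field) ab_group_add
begin

lift_definition zero_character :: "('a, 'b) character" is "\<lambda>_. 1"
  by simp

lift_definition plus_character ::
  "('a, 'b) character \<Rightarrow> ('a, 'b) character \<Rightarrow> ('a, 'b) character"
  is "\<lambda>\<chi> \<psi> x. \<chi> x * \<psi> x"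
  by simp

lift_definition uminus_character :: "('a, 'b) character \<Rightarrow> ('a, 'b) character"
  is "\<lambda>\<chi> x. inverse (\<chi> x)"
  by simp

lift_definition minus_character ::
  "('a, 'b) character \<Rightarrow> ('a, 'b) character \<Rightarrow> ('a, 'b) character"
  is "\<lambda>\<chi> \<psi> x. \<chi> x * inverse (\<psi> x)"
  by simp

instance
  by standard (transfer; auto simp: fun_eq_iff)+

end

definition supp :: "('a \<Rightarrow> 'b::zero) \<Rightarrow> 'a set" where
  "supp f = {x. f x \<noteq> 0}"

definition stabilizer :: "'a::ab_group_add set \<Rightarrow> 'a set" where
  "stabilizer S = {g. (\<lambda>x. g + x) ` S = S}"

definition fourier ::
  "('g::{ab_group_add,finite} \<Rightarrow> 'e::field) \<Rightarrow> ('g, 'e) character \<Rightarrow> 'e" where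
  "fourier f \<chi> = (\<Sum>x\<in>UNIV. f x * char_eval \<chi> (- x))"

text \<open>The constant sum of \<open>n\<close> copies of \<open>x\<close> is the multiple \<open>n x\<close> in the additive group.\<close>

definition group_exponent :: "'g::{ab_group_add,finite} itself \<Rightarrow> nat" where
  "group_exponent _ = (LEAST n. n > 0 \<and> (\<forall>x::'g. (\<Sum>i<n. x) = 0))"

definition primitive_root_of_unity :: "nat \<Rightarrow> 'e::field \<Rightarrow> bool" where
  "primitive_root_of_unity n \<zeta> \<longleftrightarrow> n > 0 \<and> \<zeta> ^ n = 1 \<and> (\<forall>k. 0 < k \<and> k < n \<longrightarrow> \<zeta> ^ k \<noteq> 1)"

text \<open>A field extension is given by its embedding; injectivity is automatic.\<close>

definition field_embedding :: "('f::field \<Rightarrow> 'e::field) \<Rightarrow> bool" where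
  "field_embedding \<iota> \<longleftrightarrow>
     \<iota> 1 = 1 \<and> (\<forall>x y. \<iota> (x + y) = \<iota> x + \<iota> y) \<and> (\<forall>x y. \<iota> (x * y) = \<iota> x * \<iota> y)"

end

theory Submission
  imports Defs
begin

text \<open>
  Let \<open>S\<close> be the support of a nonzero function on a finite abelian group \<open>A\<close> and \<open>H\<close> its
  stabilizer. The translates of \<open>S\<close> that miss \<open>0\<close> cover exactly \<open>A - H\<close>. In a minimal subcover every
  translate has a private point, so the corresponding translates of the function, together with
  one more whose support contains \<open>0\<close>, are linearly independent. This gives \<open>k\<close> independent
  translates with \<open>(k - 1) |S| \<ge> |A| - |H|\<close>. On the Fourier side a translate becomes a multiple by
  a character value, so independent translates number at most the size of the other support.
\<close>

section \<open>Linear algebra: more unknowns than equations\<close>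

text \<open>Gaussian elimination, one equation at a time. \<open>M\<close> is generalized in the
  induction because eliminating a pivot changes the matrix.\<close>

lemma homogeneous_system_nontrivial_solution:
  fixes M :: "'a \<Rightarrow> 'x \<Rightarrow> 'e::field"
  assumes "finite X" "finite A" "card X < card A"
  shows "\<exists>c. (\<exists>a\<in>A. c a \<noteq> 0) \<and> (\<forall>x\<in>X. (\<Sum>a\<in>A. c a * M a x) = 0)"
  using assms
proof (induction X arbitrary: A M rule: finite_induct)
  case empty
  then have "A \<noteq> {}" by auto
  then show ?case by (intro exI[of _ "\<lambda>_. 1"]) auto
next
  case (insert x X)
  show ?case
  proof (cases "\<forall>a\<in>A. M a x = 0")
    case True
    have "card X < card A" using insert by simp
    then obtain c where "\<exists>a\<in>A. c a \<noteq> 0" "\<forall>z\<in>X. (\<Sum>a\<in>A. c a * M a z) = 0"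
      using insert.IH[OF \<open>finite A\<close>, of M] by blast
    moreover have "(\<Sum>a\<in>A. c a * M a x) = 0" using True by simp
    ultimately show ?thesis by blast
  next
    case False
    then obtain p where p: "p \<in> A" "M p x \<noteq> 0" by blast
    define A' where "A' = A - {p}"
    have A': "finite A'" "p \<notin> A'" "A = insert p A'" "card X < card A'"
      using insert p by (auto simp: A'_def)
    obtain c where c: "\<exists>a\<in>A'. c a \<noteq> 0"
      and zero: "\<And>z. z \<in> X \<Longrightarrow> (\<Sum>a\<in>A'. c a * (M a z - M a x / M p x * M p z)) = 0"
      using insert.IH[OF A'(1,4), of "\<lambda>a z. M a z - M a x / M p x * M p z"] by blast
    define s where "s = (\<Sum>a\<in>A'. c a * M a x)"
    \<comment> \<open>The value at the pivot is the one that equation \<open>x\<close> forces once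
      the other unknowns are fixed.\<close>
    define d where "d = c(p := - s / M p x)"
    have sum_d: "(\<Sum>a\<in>A. d a * M a z) = - s / M p x * M p z + (\<Sum>a\<in>A'. c a * M a z)" for z
    proof -
      have "(\<Sum>a\<in>A'. d a * M a z) = (\<Sum>a\<in>A'. c a * M a z)"
        using A' by (intro sum.cong) (auto simp: d_def)
      then show ?thesis using A' by (simp add: d_def)
    qed
    have "(\<Sum>a\<in>A. d a * M a z) = 0" if z: "z \<in> insert x X" for z
    proof (cases "z = x")
      case True
      then show ?thesis using p by (simp add: sum_d s_def)
    next
      case False
      then have "(\<Sum>a\<in>A'. c a * M a z) = (\<Sum>a\<in>A'. c a * M a x / M p x * M p z)"
        using zero[of z] z by (simp add: algebra_simps sum_subtractf)
      also have "\<dots> = s / M p x * M p z"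
        by (simp add: s_def sum_divide_distrib sum_distrib_right)
      finally show ?thesis by (simp add: sum_d)
    qed
    moreover have "\<exists>a\<in>A. d a \<noteq> 0" using c A' by (auto simp: d_def)
    ultimately show ?thesis by blast
  qed
qed

section \<open>Minimal covers by translates\<close>

text \<open>Otherwise translation by \<open>g\<close> maps the complement of \<open>S\<close> into
  itself, hence onto itself by finiteness, and being a bijection it then also preserves
  \<open>S\<close>.\<close>

lemma not_in_stabilizerE:
  fixes S :: "'a::ab_group_add set"
  assumes fin: "finite (UNIV :: 'a set)" and g: "g \<notin> stabilizer S"
  obtains s where "s \<notin> S" "g + s \<in> S"
proof (rule ccontr)
  assume "\<not> thesis"
  with that have "(\<lambda>x. g + x) ` (- S) \<subseteq> - S" by auto
  moreover have inj: "inj (\<lambda>x. g + x)" by (simp add: inj_on_def)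
  ultimately have "(\<lambda>x. g + x) ` (- S) = - S"
    by (metis card_image card_subset_eq fin inj_on_subset finite_subset subset_UNIV)
  moreover have "surj (\<lambda>x. g + x)" by (simp add: surj_plus)
  ultimately have "(\<lambda>x. g + x) ` S = S"
    using inj by (metis bij_def bij_image_Compl_eq double_complement)
  with g show False by (simp add: stabilizer_def)
qed

text \<open>Finiteness is an assumption and not a sort, because the lemma also serves the character
  group, whose finiteness is a lemma and not a class instance.\<close>

lemma independent_translates:
  fixes F :: "'a::ab_group_add \<Rightarrow> 'e::field"
  assumes fin: "finite (UNIV :: 'a set)" and nz: "F s0 \<noteq> 0"
  obtains B where
    "card (UNIV :: 'a set) + card (supp F) \<le> card B * card (supp F) + card (stabilizer (supp F))"
    "\<forall>c. (\<forall>x. (\<Sum>b\<in>B. c b * F (x - b)) = 0) \<longrightarrow> (\<forall>b\<in>B. c b = 0)"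
proof -
  define S where "S = supp F"
  define H where "H = stabilizer S"
  have S_iff: "x \<in> S \<longleftrightarrow> F x \<noteq> 0" for x by (simp add: S_def supp_def)
  have finite_all: "finite X" for X :: "'a set" by (rule finite_subset[OF subset_UNIV fin])
  \<comment> \<open>The translate of \<open>S\<close> by \<open>a\<close> misses 0 iff
    \<open>- a \<notin> S\<close>, and it contains \<open>x\<close> iff
    \<open>x - a \<in> S\<close>.\<close>
  define covers where
    "covers A \<longleftrightarrow> (\<forall>a\<in>A. - a \<notin> S) \<and> (\<forall>x. x \<notin> H \<longrightarrow> (\<exists>a\<in>A. x - a \<in> S))" for A
  have "covers {a. - a \<notin> S}"
    unfolding covers_def
  proof (intro conjI allI impI)
    fix x assume "x \<notin> H"
    then obtain s where "s \<notin> S" "x + s \<in> S" using not_in_stabilizerE[OF fin] H_def by metis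
    then show "\<exists>a\<in>{a. - a \<notin> S}. x - a \<in> S" by (intro bexI[of _ "- s"]) auto
  qed auto
  then obtain A where A: "covers A" and min: "\<And>A'. covers A' \<Longrightarrow> card A \<le> card A'"
    using ex_has_least_nat[of covers _ card] by blast
  \<comment> \<open>Dropping \<open>a\<close> keeps all translates away from 0, so by minimality
    some point outside \<open>H\<close> is no longer covered; only \<open>a\<close> covered
    it.\<close>
  have private_point: "\<exists>x. x - a \<in> S \<and> (\<forall>b\<in>A - {a}. x - b \<notin> S)" if a: "a \<in> A" for a
  proof -
    have "\<not> covers (A - {a})"
      using min[of "A - {a}"] card_Diff1_less[OF finite_all a] by auto
    with A obtain x where "x \<notin> H" "\<forall>b\<in>A - {a}. x - b \<notin> S" by (auto simp: covers_def)
    with A show ?thesis by (metis DiffI covers_def singletonD)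
  qed
  define B where "B = insert (- s0) A"
  have s0: "- s0 \<notin> A" using A nz by (auto simp: covers_def S_iff)
  have "UNIV - H \<subseteq> (\<Union>a\<in>A. (\<lambda>x. a + x) ` S)"
  proof
    fix x assume "x \<in> UNIV - H"
    then obtain a where "a \<in> A" "x - a \<in> S" using A by (auto simp: covers_def)
    then show "x \<in> (\<Union>a\<in>A. (\<lambda>x. a + x) ` S)" by (auto intro!: bexI[of _ a] image_eqI[of _ _ "x - a"])
  qed
  then have "card (UNIV - H) \<le> card (\<Union>a\<in>A. (\<lambda>x. a + x) ` S)" by (intro card_mono finite_all)
  also have "\<dots> \<le> (\<Sum>a\<in>A. card ((\<lambda>x. a + x) ` S))" by (intro card_UN_le finite_all)
  also have "\<dots> \<le> (\<Sum>a\<in>A. card S)" by (intro sum_mono card_image_le finite_all)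
  finally have "card (UNIV - H) \<le> card A * card S" by simp
  moreover have "card (UNIV - H) = card (UNIV :: 'a set) - card H"
    by (intro card_Diff_subset finite_all) auto
  \<comment> \<open>\<open>B\<close> has one element more than \<open>A\<close>; this accounts for
    the extra \<open>card S\<close> on the left.\<close>
  ultimately have "card (UNIV :: 'a set) + card S \<le> card B * card S + card H"
    using s0 by (simp add: B_def finite_all)
  moreover have "c b = 0" if zero: "\<And>x. (\<Sum>b\<in>B. c b * F (x - b)) = 0" and b: "b \<in> B" for c b
  proof -
    have split: "c (- s0) * F (x + s0) + (\<Sum>b\<in>A. c b * F (x - b)) = 0" for x
      using zero[of x] s0 by (simp add: B_def finite_all)
    \<comment> \<open>Private points are private only within \<open>A\<close>, so the coefficient at
      \<open>- s0\<close> has to go first: at 0 all translates from \<open>A\<close> vanish, while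
      the one by \<open>- s0\<close> has the value \<open>F s0\<close>.\<close>
    have "(\<Sum>b\<in>A. c b * F (0 - b)) = 0"
      using A by (intro sum.neutral) (auto simp: covers_def S_iff)
    with split[of 0] nz have c0: "c (- s0) = 0" by simp
    show ?thesis
    proof (cases "b = - s0")
      case False
      with b have bA: "b \<in> A" by (simp add: B_def)
      then obtain x where x: "x - b \<in> S" "\<forall>a\<in>A - {b}. x - a \<notin> S" using private_point by blast
      have "(\<Sum>a\<in>A. c a * F (x - a)) = c b * F (x - b) + (\<Sum>a\<in>A - {b}. c a * F (x - a))"
        by (intro sum.remove finite_all bA)
      also have "(\<Sum>a\<in>A - {b}. c a * F (x - a)) = 0"
        using x by (intro sum.neutral) (auto simp: S_iff)
      finally show ?thesis using split[of x] c0 x by (simp add: S_iff)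
    qed (simp add: c0)
  qed
  ultimately show thesis by (intro that[of B]) (auto simp: S_def H_def)
qed

section \<open>Multiples and the group exponent\<close>

text \<open>Names the constant sum in \<open>group_exponent\<close>, so that it can be handled by
  recursion on \<open>n\<close>.\<close>

definition multiple :: "nat \<Rightarrow> 'g::ab_group_add \<Rightarrow> 'g" where
  "multiple n x = (\<Sum>i<n. x)"

lemma multiple_0 [simp]: "multiple 0 x = 0"
  and multiple_Suc [simp]: "multiple (Suc n) x = x + multiple n x"
  by (simp_all add: multiple_def add.commute)

lemma multiple_zero [simp]: "multiple n 0 = 0"
  by (induction n) auto

lemma multiple_add: "multiple (m + n) x = multiple m x + multiple n x"
  by (induction m) (auto simp: algebra_simps)

lemma multiple_mult: "multiple (m * n) x = multiple m (multiple n x)"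
  by (induction m) (auto simp: multiple_add)

lemma ex_multiple_eq_0:
  fixes x :: "'g::{ab_group_add,finite}"
  shows "\<exists>n>0. multiple n x = 0"
proof -
  have "\<not> inj (\<lambda>n. multiple n x)"
    using finite_imageD[of "\<lambda>n. multiple n x" UNIV] by auto
  then obtain i j where "i < j" "multiple i x = multiple j x"
    by (auto simp: inj_on_def) (metis linorder_neqE_nat)
  then have "multiple (j - i) x = 0"
    using multiple_add[of "j - i" i x] by simp
  with \<open>i < j\<close> show ?thesis by (metis zero_less_diff)
qed

text \<open>The \<open>LEAST\<close> is meaningful once some positive number kills the whole group;
  the product of one such number per element does.\<close>

lemma multiple_group_exponent:
  fixes x :: "'g::{ab_group_add,finite}"
  shows "multiple (group_exponent TYPE('g)) x = 0"
proof -
  obtain n :: "'g \<Rightarrow> nat" where n: "\<And>x. n x > 0" "\<And>x. multiple (n x) x = 0"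
    using ex_multiple_eq_0 by metis
  have "multiple (prod n UNIV) y = 0" for y :: 'g
  proof -
    have "n y dvd prod n UNIV" by (intro dvd_prodI) auto
    then obtain k where "prod n UNIV = k * n y" by (metis dvdE mult.commute)
    then show ?thesis by (simp add: multiple_mult n)
  qed
  then have "prod n UNIV > 0 \<and> (\<forall>x::'g. (\<Sum>i<prod n UNIV. x) = 0)"
    using n by (auto simp: multiple_def intro: prod_pos)
  from LeastI[of "\<lambda>n. n > 0 \<and> (\<forall>x::'g. (\<Sum>i<n. x) = 0)", OF this]
  show ?thesis by (simp add: group_exponent_def multiple_def)
qed

section \<open>Roots of unity in a field\<close>

lemma nth_roots_of_unity:
  fixes n :: nat
  assumes "n > 0"
  shows finite_nth_roots_of_unity: "finite {z::'e::field. z ^ n = 1}"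
    and card_nth_roots_of_unity_le: "card {z::'e. z ^ n = 1} \<le> n"
proof -
  define p :: "'e poly" where "p = monom 1 n - 1"
  \<comment> \<open>With \<open>n > 0\<close> the constant term does not interfere with the leading
    coefficient.\<close>
  have "coeff p n = 1" using assms by (simp add: p_def)
  then have "p \<noteq> 0" by auto
  have eq: "{z. z ^ n = 1} = {z. poly p z = 0}" by (simp add: p_def poly_monom)
  have "degree p \<le> n" unfolding p_def by (intro degree_diff_le degree_monom_le) auto
  then show "card {z::'e. z ^ n = 1} \<le> n"
    unfolding eq using card_poly_roots_bound[OF \<open>p \<noteq> 0\<close>] by linarith
  show "finite {z::'e. z ^ n = 1}"
    unfolding eq by (rule poly_roots_finite[OF \<open>p \<noteq> 0\<close>])
qed

lemma primitive_root_of_unity_inj: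
  assumes "primitive_root_of_unity n (\<zeta>::'e::field)"
  shows "inj_on (\<lambda>i. \<zeta> ^ i) {..<n}"
proof -
  have \<zeta>0: "\<zeta> \<noteq> 0" using assms by (auto simp: primitive_root_of_unity_def power_0_left)
  have "i = j" if "i \<le> j" "j < n" "\<zeta> ^ i = \<zeta> ^ j" for i j
  proof -
    have "\<zeta> ^ i * \<zeta> ^ (j - i) = \<zeta> ^ i" using that by (metis le_add_diff_inverse power_add)
    then have "\<zeta> ^ (j - i) = 1" using \<zeta>0 by simp
    then have "\<not> 0 < j - i"
      using assms that unfolding primitive_root_of_unity_def by (meson le_less_trans diff_le_self)
    then show ?thesis using that by simp
  qed
  then show ?thesis by (intro inj_onI) (metis lessThan_iff nat_le_linear)
qed

text \<open>The powers \<open>\<zeta> ^ (m * i)\<close> with \<open>i < k\<close> are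
  \<open>k\<close> distinct \<open>k\<close>-th roots of unity. There are at most \<open>k\<close>,
  so \<open>c\<close> is one of them, and \<open>\<zeta> ^ i\<close> is the required root.\<close>

lemma root_of_root_of_unity:
  assumes prim: "primitive_root_of_unity (m * k) (\<zeta>::'e::field)" and c: "(c::'e) ^ k = 1"
  shows "\<exists>y. y ^ m = c"
proof -
  have pos: "m > 0" "k > 0" using prim by (auto simp: primitive_root_of_unity_def)
  let ?R = "(\<lambda>i. \<zeta> ^ (m * i)) ` {..<k}"
  have "inj_on ((\<lambda>i. \<zeta> ^ i) \<circ> (\<lambda>i. m * i)) {..<k}"
    using pos by (intro comp_inj_on inj_on_subset[OF primitive_root_of_unity_inj[OF prim]])
      (auto simp: inj_on_def)
  then have "inj_on (\<lambda>i. \<zeta> ^ (m * i)) {..<k}" by (simp add: comp_def)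
  then have card: "card ?R = k" by (simp add: card_image)
  have sub: "?R \<subseteq> {z. z ^ k = 1}"
  proof safe
    fix i
    have "(\<zeta> ^ (m * i)) ^ k = (\<zeta> ^ (m * k)) ^ i" by (simp add: mult.commute mult.left_commute flip: power_mult)
    then show "(\<zeta> ^ (m * i)) ^ k = 1" using prim by (simp add: primitive_root_of_unity_def)
  qed
  have "?R = {z. z ^ k = 1}"
    using card_seteq[OF finite_nth_roots_of_unity[OF \<open>k > 0\<close>] sub]
      card card_nth_roots_of_unity_le[OF \<open>k > 0\<close>, where 'e='e] by simp
  with c obtain i where "c = \<zeta> ^ (m * i)" by blast
  then show ?thesis by (metis mult.commute power_mult)
qed

section \<open>Extension of characters from subgroups\<close>

text \<open>A character of the subgroup \<open>K\<close>, encoded as a total function with arbitrary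
  values outside \<open>K\<close>; that \<open>K\<close> is a subgroup is part of the
  condition.\<close>

definition partial_character :: "'g::ab_group_add set \<Rightarrow> ('g \<Rightarrow> 'e::field) \<Rightarrow> bool" where
  "partial_character K \<chi> \<longleftrightarrow> 0 \<in> K \<and> (\<forall>x\<in>K. \<forall>y\<in>K. x + y \<in> K \<and> \<chi> (x + y) = \<chi> x * \<chi> y) \<and>
     (\<forall>x\<in>K. - x \<in> K \<and> \<chi> x \<noteq> 0)"

lemma partial_character_zero: "partial_character K \<chi> \<Longrightarrow> \<chi> 0 = 1"
  unfolding partial_character_def by (metis add.left_neutral mult_cancel_right1)

lemma partial_character_multiple:
  assumes "partial_character K \<chi>" "x \<in> K"
  shows "multiple n x \<in> K \<and> \<chi> (multiple n x) = \<chi> x ^ n"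
  using assms partial_character_zero[OF assms(1)]
  by (induction n) (auto simp: partial_character_def)

text \<open>The index \<open>m\<close> is the order of \<open>x\<close> modulo \<open>K\<close>; a value at \<open>x\<close> can be prescribed as soon as its
  \<open>m\<close>-th power is right.\<close>

lemma partial_character_extend:
  fixes x :: "'g::{ab_group_add,finite}" and \<chi> :: "'g \<Rightarrow> 'e::field"
  assumes \<chi>: "partial_character K \<chi>"
    and m: "\<And>i. multiple i x \<in> K \<longleftrightarrow> m dvd i" and "m > 0"
    and y: "y ^ m = \<chi> (multiple m x)"
  obtains K' \<chi>' where "partial_character K' \<chi>'" "K \<subseteq> K'" "x \<in> K'" "\<And>h. h \<in> K \<Longrightarrow> \<chi>' h = \<chi> h"
    "\<chi>' x = y"
proof -
  have zero: "0 \<in> K" and add: "\<And>a b. a \<in> K \<Longrightarrow> b \<in> K \<Longrightarrow> a + b \<in> K"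
    and mult: "\<And>a b. a \<in> K \<Longrightarrow> b \<in> K \<Longrightarrow> \<chi> (a + b) = \<chi> a * \<chi> b"
    and neg: "\<And>a. a \<in> K \<Longrightarrow> - a \<in> K" and nz: "\<And>a. a \<in> K \<Longrightarrow> \<chi> a \<noteq> 0"
    using \<chi> by (auto simp: partial_character_def)
  have mx: "multiple m x \<in> K" using m by simp
  have "y \<noteq> 0" using y nz[OF mx] \<open>m > 0\<close> by (auto simp: power_0_left)
  \<comment> \<open>Two expressions of one element differ by \<open>multiple (j - i) x\<close>,
    which lies in \<open>K\<close> and so is a multiple of \<open>multiple m x\<close>; there \<chi>
    agrees with the powers of \<open>y\<close>. Taking \<open>i \<le> j\<close> keeps the difference
    natural.\<close>
  have wd_le: "\<chi> h * y ^ i = \<chi> h' * y ^ j"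
    if "i \<le> j" "h \<in> K" "h' \<in> K" "h + multiple i x = h' + multiple j x" for h h' i j
  proof -
    have h: "h = h' + multiple (j - i) x"
      using that multiple_add[of "j - i" i x] by (simp add: algebra_simps)
    then have "multiple (j - i) x = h + - h'" by simp
    then have "multiple (j - i) x \<in> K" using add neg that by metis
    then obtain q where q: "j - i = m * q" using m by auto
    then have mq: "multiple (j - i) x = multiple q (multiple m x)"
      by (simp add: mult.commute flip: multiple_mult)
    have "\<chi> (multiple (j - i) x) = y ^ (j - i)"
      unfolding mq using partial_character_multiple[OF \<chi> mx, of q] y q by (simp add: power_mult)
    then have "\<chi> h = \<chi> h' * y ^ (j - i)"
      using h mult[OF \<open>h' \<in> K\<close> \<open>multiple (j - i) x \<in> K\<close>] by simp
    then show ?thesis using that by (simp add: mult.assoc flip: power_add)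
  qed
  have wd: "\<chi> h * y ^ i = \<chi> h' * y ^ j"
    if "h \<in> K" "h' \<in> K" "h + multiple i x = h' + multiple j x" for h h' i j
    using wd_le that by (metis nat_le_linear)
  define K' where "K' = {h + multiple i x |h i. h \<in> K}"
  \<comment> \<open>By \<open>wd\<close> the choice does not depend on the expression of
    \<open>k\<close>.\<close>
  define \<chi>' where "\<chi>' k = (SOME v. \<exists>h i. h \<in> K \<and> k = h + multiple i x \<and> v = \<chi> h * y ^ i)" for k
  have val: "\<chi>' (h + multiple i x) = \<chi> h * y ^ i" if "h \<in> K" for h i
    unfolding \<chi>'_def
  proof (rule some_equality)
    show "\<exists>h' j. h' \<in> K \<and> h + multiple i x = h' + multiple j x \<and> \<chi> h * y ^ i = \<chi> h' * y ^ j"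
      using that by blast
  qed (use that wd in metis)
  have "partial_character K' \<chi>'"
    unfolding partial_character_def
  proof (intro conjI ballI)
    show "0 \<in> K'" unfolding K'_def using zero by (auto intro!: exI[of _ 0])
  next
    fix a b assume "a \<in> K'" "b \<in> K'"
    then obtain h i h' j where *: "a = h + multiple i x" "b = h' + multiple j x" "h \<in> K" "h' \<in> K"
      by (auto simp: K'_def)
    have ab: "a + b = (h + h') + multiple (i + j) x" using * by (simp add: multiple_add algebra_simps)
    show "a + b \<in> K'" unfolding ab K'_def using * add by blast
    show "\<chi>' (a + b) = \<chi>' a * \<chi>' b"
      unfolding ab using * val add mult by (simp add: power_add)
  next
    fix a assume "a \<in> K'"
    then obtain h i where *: "a = h + multiple i x" "h \<in> K" by (auto simp: K'_def)
    \<comment> \<open>\<open>K'\<close> is built from natural multiples only, so the negative of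
      \<open>multiple i x\<close> has to be rewritten as
      \<open>multiple (i * (n - 1)) x\<close>.\<close>
    obtain n where n: "n > 0" "multiple n x = 0" using ex_multiple_eq_0 by blast
    have "multiple i x + multiple (i * (n - 1)) x = multiple (i * n) x"
      using n by (simp add: algebra_simps flip: multiple_add)
    also have "\<dots> = 0" using n by (simp add: multiple_mult)
    finally have "- multiple i x = multiple (i * (n - 1)) x" by (rule minus_unique)
    then have "- a = - h + multiple (i * (n - 1)) x" using * by simp
    then show "- a \<in> K'" unfolding K'_def using neg * by blast
    show "\<chi>' a \<noteq> 0" using * val nz \<open>y \<noteq> 0\<close> by simp
  qed
  moreover have "K \<subseteq> K'" unfolding K'_def by (force intro: exI[of _ "0::nat"])
  moreover have "x \<in> K'" unfolding K'_def using zero by (auto intro!: exI[of _ 0] exI[of _ 1])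
  moreover have "\<chi>' h = \<chi> h" if "h \<in> K" for h using val[OF that, of 0] by simp
  moreover have "\<chi>' x = y" using val[OF zero, of 1] partial_character_zero[OF \<chi>] by simp
  ultimately show thesis using that by blast
qed

text \<open>\<open>m\<close> is the least positive number with \<open>multiple m x \<in> K\<close>;
  division with remainder gives the divisibility.\<close>

lemma order_modulo_subgroup:
  fixes x :: "'g::{ab_group_add,finite}"
  assumes \<chi>: "partial_character K (\<chi> :: 'g \<Rightarrow> 'e::field)"
  obtains m where "m > 0" "\<And>i. multiple i x \<in> K \<longleftrightarrow> m dvd i"
proof -
  have zero: "0 \<in> K" and add: "\<And>a b. a \<in> K \<Longrightarrow> b \<in> K \<Longrightarrow> a + b \<in> K"
    and neg: "\<And>a. a \<in> K \<Longrightarrow> - a \<in> K"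
    using \<chi> by (auto simp: partial_character_def)
  define m where "m = (LEAST n. n > 0 \<and> multiple n x \<in> K)"
  have "\<exists>n. n > 0 \<and> multiple n x \<in> K" using ex_multiple_eq_0[of x] zero by force
  then have m: "m > 0" "multiple m x \<in> K"
    using LeastI_ex[of "\<lambda>n. n > 0 \<and> multiple n x \<in> K"] by (auto simp: m_def)
  have mq: "multiple (q * m) x \<in> K" for q
    using partial_character_multiple[OF \<chi> m(2), of q] by (simp add: multiple_mult)
  have "m dvd i" if i: "multiple i x \<in> K" for i
  proof (rule ccontr)
    assume "\<not> m dvd i"
    then have r: "i mod m > 0" "i mod m < m" using m by (auto simp: mod_greater_zero_iff_not_dvd)
    have "multiple (i mod m) x = multiple i x + - multiple (i div m * m) x"
      using multiple_add[of "i div m * m" "i mod m" x] by simp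
    then have "multiple (i mod m) x \<in> K" using i mq add neg by metis
    with r not_less_Least[of "i mod m" "\<lambda>n. n > 0 \<and> multiple n x \<in> K"] show False
      by (simp add: m_def)
  qed
  moreover have "multiple i x \<in> K" if "m dvd i" for i
    using that mq by (auto simp: mult.commute)
  ultimately show thesis using that m by blast
qed

text \<open>Adjoin one element \<open>x\<close> at a time. Its order \<open>m\<close> modulo
  \<open>K\<close> divides the exponent, say \<open>m * k\<close>, so the value at
  \<open>multiple m x\<close> is a \<open>k\<close>-th root of unity and has an \<open>m\<close>-th
  root to assign to \<open>x\<close>.\<close>

lemma partial_character_extend_UNIV:
  fixes \<chi> :: "'g::{ab_group_add,finite} \<Rightarrow> 'e::field"
  assumes prim: "primitive_root_of_unity (group_exponent TYPE('g)) (\<zeta>::'e)"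
    and \<chi>: "partial_character K \<chi>"
  shows "\<exists>\<psi> :: ('g, 'e) character. \<forall>h\<in>K. char_eval \<psi> h = \<chi> h"
  using \<chi>
proof (induction "card (- K)" arbitrary: K \<chi> rule: less_induct)
  case less
  show ?case
  proof (cases "K = UNIV")
    case True
    have "char_eval (Character \<chi>) = \<chi>"
      using less.prems True by (intro Character_inverse) (auto simp: partial_character_def)
    then show ?thesis by metis
  next
    case False
    then obtain x where x: "x \<notin> K" by blast
    obtain m where m: "m > 0" "\<And>i. multiple i x \<in> K \<longleftrightarrow> m dvd i"
      using order_modulo_subgroup[OF less.prems] by metis
    have "0 \<in> K" using less.prems by (simp add: partial_character_def)
    then have "m dvd group_exponent TYPE('g)" using m multiple_group_exponent[of x] by metis
    then obtain k where k: "group_exponent TYPE('g) = m * k" by blast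
    have "\<chi> (multiple m x) ^ k = \<chi> (multiple k (multiple m x))"
      using partial_character_multiple[OF less.prems, of "multiple m x"] m by simp
    also have "multiple k (multiple m x) = 0"
      using k multiple_group_exponent[of x] by (simp add: mult.commute flip: multiple_mult)
    finally have "\<chi> (multiple m x) ^ k = 1" using partial_character_zero[OF less.prems] by simp
    then obtain y where "y ^ m = \<chi> (multiple m x)"
      using root_of_root_of_unity prim k by metis
    then obtain K' \<chi>' where K': "partial_character K' \<chi>'" "K \<subseteq> K'" "x \<in> K'"
      "\<And>h. h \<in> K \<Longrightarrow> \<chi>' h = \<chi> h"
      using partial_character_extend[OF less.prems m(2,1)] by metis
    have "card (- K') < card (- K)" using K' x by (intro psubset_card_mono) auto
    from less.hyps[OF this K'(1)] K' show ?thesis by force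
  qed
qed

text \<open>Starting from the trivial subgroup, \<open>x\<close> of order \<open>m\<close> may be
  given any \<open>m\<close>-th root of unity. With exponent \<open>m * k\<close>, the choice
  \<open>\<zeta> ^ k\<close> differs from 1 because \<open>0 < k < m * k\<close>.\<close>

lemma ex_character_ne_1:
  fixes x :: "'g::{ab_group_add,finite}"
  assumes prim: "primitive_root_of_unity (group_exponent TYPE('g)) (\<zeta>::'e::field)" and "x \<noteq> 0"
  shows "\<exists>\<psi> :: ('g, 'e) character. char_eval \<psi> x \<noteq> 1"
proof -
  have triv: "partial_character {0::'g} (\<lambda>_. 1::'e)" by (simp add: partial_character_def)
  obtain m where m: "m > 0" "\<And>i. multiple i x \<in> {0} \<longleftrightarrow> m dvd i"
    using order_modulo_subgroup[OF triv] by metis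
  have "m \<noteq> 1" using m(2)[of 1] \<open>x \<noteq> 0\<close> by auto
  have "m dvd group_exponent TYPE('g)" using m multiple_group_exponent[of x] by (metis singletonI)
  then obtain k where k: "group_exponent TYPE('g) = m * k" by blast
  then have "k > 0" "k < m * k"
    using prim m \<open>m \<noteq> 1\<close> by (auto simp: primitive_root_of_unity_def)
  then have ne: "\<zeta> ^ k \<noteq> 1" using prim k by (simp add: primitive_root_of_unity_def)
  have "(\<zeta> ^ k) ^ m = 1"
    using prim k by (simp add: primitive_root_of_unity_def mult.commute flip: power_mult)
  then obtain K' \<chi>' where "partial_character K' \<chi>'" "x \<in> K'" "\<chi>' x = \<zeta> ^ k"
    using partial_character_extend[OF triv m(2,1)] by metis
  with partial_character_extend_UNIV[OF prim] ne show ?thesis by metis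
qed

section \<open>Values of characters and finiteness of the dual\<close>

lemma char_eval_add: "char_eval \<chi> (x + y) = char_eval \<chi> x * char_eval \<chi> y"
  and char_eval_nonzero: "char_eval \<chi> x \<noteq> 0"
  using char_eval[of \<chi>] by auto

lemma char_eval_0: "char_eval \<chi> 0 = 1"
  using char_eval_add[of \<chi> 0 0] char_eval_nonzero[of \<chi> 0] by simp

lemma char_eval_minus: "char_eval \<chi> (- x) = inverse (char_eval \<chi> x)"
proof -
  have "char_eval \<chi> x * char_eval \<chi> (- x) = 1" by (simp add: char_eval_0 flip: char_eval_add)
  then show ?thesis by (metis inverse_unique)
qed

lemma char_eval_multiple: "char_eval \<chi> (multiple n x) = char_eval \<chi> x ^ n"
  by (induction n) (auto simp: char_eval_0 char_eval_add)

text \<open>All values are roots of unity of order dividing the exponent, so characters embed into a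
  finite set of functions.\<close>

lemma finite_characters:
  assumes "group_exponent TYPE('g::{ab_group_add,finite}) > 0"
  shows "finite (UNIV :: ('g, 'e::field) character set)"
proof -
  let ?N = "group_exponent TYPE('g)"
  have "char_eval \<chi> x ^ ?N = 1" for \<chi> :: "('g, 'e) character" and x
    using char_eval_multiple[of \<chi> ?N x] by (simp add: multiple_group_exponent char_eval_0)
  then have "range (char_eval :: ('g, 'e) character \<Rightarrow> _) \<subseteq> PiE UNIV (\<lambda>_. {z. z ^ ?N = 1})"
    by auto
  then have "finite (range (char_eval :: ('g, 'e) character \<Rightarrow> _))"
    by (rule finite_subset) (intro finite_PiE finite finite_nth_roots_of_unity assms)
  then show ?thesis
    by (rule finite_imageD) (simp add: inj_on_def char_eval_inject)
qed

section \<open>Injectivity of the Fourier transform\<close>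

lemma fourier_eq_0_imp_eq_0:
  fixes F :: "'g::{ab_group_add,finite} \<Rightarrow> 'e::field"
  assumes prim: "primitive_root_of_unity (group_exponent TYPE('g)) (\<zeta>::'e)"
    and zero: "\<And>\<chi>. fourier F \<chi> = 0"
  shows "F y = 0"
proof -
  have "\<exists>\<psi> :: ('g, 'e) character. char_eval \<psi> (- y) \<noteq> char_eval \<psi> (- a)" if "a \<noteq> y" for a
  proof -
    obtain \<psi> :: "('g, 'e) character" where "char_eval \<psi> (a - y) \<noteq> 1"
      using ex_character_ne_1[OF prim, of "a - y"] \<open>a \<noteq> y\<close> by auto
    moreover have "char_eval \<psi> (- y) = char_eval \<psi> (a - y) * char_eval \<psi> (- a)"
      by (simp flip: char_eval_add)
    ultimately show ?thesis using char_eval_nonzero by (metis mult_cancel_right1)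
  qed
  then obtain \<psi> :: "'g \<Rightarrow> ('g, 'e) character" where
    sep: "\<And>a. a \<noteq> y \<Longrightarrow> char_eval (\<psi> a) (- y) \<noteq> char_eval (\<psi> a) (- a)" by metis
  \<comment> \<open>Since the characters separate points, a multiple of the indicator of \<open>y\<close> is a product of
    differences of characters and constants, hence a combination of characters.\<close>
  define g where "g A x = (\<Prod>a\<in>A. char_eval (\<psi> a) (- x) - char_eval (\<psi> a) (- a))" for A x
  \<comment> \<open>Each new factor is a character minus a constant. Multiplying by the character
    only replaces \<chi> by \<open>\<psi> a + \<chi>\<close>, so the induction needs \<chi>
    arbitrary.\<close>
  have orth: "(\<Sum>x\<in>UNIV. F x * g A x * char_eval \<chi> (- x)) = 0" for A \<chi>
    using finite[of A]
  proof (induction A arbitrary: \<chi> rule: finite_induct)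
    case empty
    then show ?case using zero[of \<chi>] by (simp add: g_def fourier_def)
  next
    case (insert a A)
    have "F x * g (insert a A) x * char_eval \<chi> (- x) =
        F x * g A x * char_eval (\<psi> a + \<chi>) (- x) -
        char_eval (\<psi> a) (- a) * (F x * g A x * char_eval \<chi> (- x))" for x
      using insert.hyps by (simp add: g_def plus_character.rep_eq algebra_simps)
    then show ?case
      by (simp add: sum_subtractf insert.IH flip: sum_distrib_left)
  qed
  have "g (UNIV - {y}) x = 0" if "x \<noteq> y" for x
    unfolding g_def using that by (intro prod_zero) auto
  then have "(\<Sum>x\<in>UNIV. F x * g (UNIV - {y}) x * char_eval 0 (- x)) =
      (\<Sum>x\<in>{y}. F x * g (UNIV - {y}) x * char_eval 0 (- x))"
    by (intro sum.mono_neutral_right) auto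
  then have "F y * g (UNIV - {y}) y = 0"
    using orth[of "UNIV - {y}" 0] by (simp add: zero_character.rep_eq)
  moreover have "g (UNIV - {y}) y \<noteq> 0" using sep by (auto simp: g_def)
  ultimately show ?thesis by simp
qed

text \<open>With fewer characters than group elements, the equations
  \<open>fourier F \<chi> = 0\<close> would have a nonzero solution \<open>F\<close>, against
  injectivity.\<close>

lemma card_le_card_characters:
  assumes prim: "primitive_root_of_unity (group_exponent TYPE('g::{ab_group_add,finite})) (\<zeta>::'e::field)"
  shows "card (UNIV :: 'g set) \<le> card (UNIV :: ('g, 'e) character set)"
proof (rule ccontr)
  assume "\<not> ?thesis"
  moreover have "finite (UNIV :: ('g, 'e) character set)"
    using prim by (intro finite_characters) (simp add: primitive_root_of_unity_def)
  ultimately obtain F :: "'g \<Rightarrow> 'e" where F: "\<exists>x. F x \<noteq> 0"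
    and "\<And>\<chi> :: ('g, 'e) character. (\<Sum>x\<in>UNIV. F x * char_eval \<chi> (- x)) = 0"
    using homogeneous_system_nontrivial_solution
      [of "UNIV :: ('g, 'e) character set" "UNIV :: 'g set" "\<lambda>x \<chi>. char_eval \<chi> (- x)"] by auto
  then have "fourier F \<chi> = 0" for \<chi> by (simp add: fourier_def)
  then have "F x = 0" for x using fourier_eq_0_imp_eq_0[OF prim] by blast
  with F show False by simp
qed

section \<open>Translates, modulations and the two inequalities\<close>

lemma fourier_shift:
  "fourier F (\<chi> - \<psi>) = (\<Sum>x\<in>UNIV. F x * char_eval \<chi> (- x) * char_eval \<psi> x)"
  by (simp add: fourier_def minus_character.rep_eq char_eval_minus mult.assoc)

lemma fourier_translate:
  "fourier (\<lambda>x. F (x - b)) \<chi> = char_eval \<chi> (- b) * fourier F \<chi>"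
proof -
  have "fourier (\<lambda>x. F (x - b)) \<chi> = (\<Sum>x\<in>UNIV. F x * char_eval \<chi> (- (x + b)))"
    unfolding fourier_def
    by (rule sum.reindex_bij_witness[of _ "\<lambda>x. x + b" "\<lambda>x. x - b"]) auto
  then show ?thesis
    using char_eval_add[of \<chi> "- b"] by (simp add: fourier_def sum_distrib_left algebra_simps)
qed

text \<open>A combination of translates of the transform is the transform of \<open>F\<close> times
  a combination of characters. If there were more translates than points of \<open>supp F\<close>,
  some nontrivial combination of characters would vanish on \<open>supp F\<close>, contradicting
  independence.\<close>

lemma uncertainty_stabilizer_fourier:
  fixes F :: "'g::{ab_group_add,finite} \<Rightarrow> 'e::field"
  assumes prim: "primitive_root_of_unity (group_exponent TYPE('g)) (\<zeta>::'e)" and "F y \<noteq> 0"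
  shows "card (UNIV :: 'g set) + card (supp (fourier F))
    \<le> card (supp F) * card (supp (fourier F)) + card (stabilizer (supp (fourier F)))"
proof -
  have fin: "finite (UNIV :: ('g, 'e) character set)"
    using prim by (intro finite_characters) (simp add: primitive_root_of_unity_def)
  obtain \<chi>0 where \<chi>0: "fourier F \<chi>0 \<noteq> 0" using fourier_eq_0_imp_eq_0[OF prim] \<open>F y \<noteq> 0\<close> by metis
  obtain B where B: "card (UNIV :: ('g, 'e) character set) + card (supp (fourier F))
      \<le> card B * card (supp (fourier F)) + card (stabilizer (supp (fourier F)))"
    and ind: "\<forall>c. (\<forall>\<chi>. (\<Sum>b\<in>B. c b * fourier F (\<chi> - b)) = 0) \<longrightarrow> (\<forall>b\<in>B. c b = 0)"
    by (rule independent_translates[OF fin, of "fourier F", OF \<chi>0])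
  have "card B \<le> card (supp F)"
  proof (rule ccontr)
    assume "\<not> ?thesis"
    then obtain c where c: "\<exists>b\<in>B. c b \<noteq> 0"
      and zero: "\<And>x. x \<in> supp F \<Longrightarrow> (\<Sum>b\<in>B. c b * char_eval b x) = 0"
      using homogeneous_system_nontrivial_solution[of "supp F" B char_eval]
        finite_subset[OF subset_UNIV fin] by auto
    have "(\<Sum>b\<in>B. c b * fourier F (\<chi> - b)) = 0" for \<chi>
    proof -
      have "(\<Sum>b\<in>B. c b * fourier F (\<chi> - b)) =
          (\<Sum>x\<in>UNIV. \<Sum>b\<in>B. c b * (F x * char_eval \<chi> (- x) * char_eval b x))"
        unfolding fourier_shift sum_distrib_left by (rule sum.swap)
      also have "\<dots> = (\<Sum>x\<in>UNIV. F x * char_eval \<chi> (- x) * (\<Sum>b\<in>B. c b * char_eval b x))"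
        by (simp add: sum_distrib_left mult.left_commute)
      also have "\<dots> = 0" using zero by (intro sum.neutral) (auto simp: supp_def)
      finally show ?thesis .
    qed
    with ind c show False by blast
  qed
  then have "card B * card (supp (fourier F)) \<le> card (supp F) * card (supp (fourier F))" by simp
  \<comment> \<open>\<open>B\<close> is stated with the size of the dual; this is at least the size
    of the group.\<close>
  with B card_le_card_characters[OF prim] show ?thesis by linarith
qed

text \<open>The same count on the group side: the transform of a combination of translates is the
  transform of \<open>F\<close> times a combination of character values, one equation per point of
  \<open>supp (fourier F)\<close>.\<close>

lemma uncertainty_stabilizer:
  fixes F :: "'g::{ab_group_add,finite} \<Rightarrow> 'e::field"
  assumes prim: "primitive_root_of_unity (group_exponent TYPE('g)) (\<zeta>::'e)" and "F y \<noteq> 0"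
  shows "card (UNIV :: 'g set) + card (supp F)
    \<le> card (supp F) * card (supp (fourier F)) + card (stabilizer (supp F))"
proof -
  have fin: "finite (UNIV :: ('g, 'e) character set)"
    using prim by (intro finite_characters) (simp add: primitive_root_of_unity_def)
  obtain B where B: "card (UNIV :: 'g set) + card (supp F)
      \<le> card B * card (supp F) + card (stabilizer (supp F))"
    and ind: "\<forall>c. (\<forall>x. (\<Sum>b\<in>B. c b * F (x - b)) = 0) \<longrightarrow> (\<forall>b\<in>B. c b = 0)"
    by (rule independent_translates[OF finite, of F, OF \<open>F y \<noteq> 0\<close>])
  have "card B \<le> card (supp (fourier F))"
  proof (rule ccontr)
    assume "\<not> ?thesis"
    then obtain c where c: "\<exists>b\<in>B. c b \<noteq> 0"
      and zero: "\<And>\<chi>. \<chi> \<in> supp (fourier F) \<Longrightarrow> (\<Sum>b\<in>B. c b * char_eval \<chi> (- b)) = 0"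
      using homogeneous_system_nontrivial_solution
        [of "supp (fourier F)" B "\<lambda>b \<chi>. char_eval \<chi> (- b)"] finite_subset[OF subset_UNIV fin]
      by auto
    have "fourier (\<lambda>x. \<Sum>b\<in>B. c b * F (x - b)) \<chi> = 0" for \<chi>
    proof -
      have "fourier (\<lambda>x. \<Sum>b\<in>B. c b * F (x - b)) \<chi> =
          (\<Sum>b\<in>B. c b * fourier (\<lambda>x. F (x - b)) \<chi>)"
        unfolding fourier_def sum_distrib_left sum_distrib_right
        by (subst sum.swap) (simp add: mult.assoc)
      also have "\<dots> = (\<Sum>b\<in>B. c b * char_eval \<chi> (- b)) * fourier F \<chi>"
        by (simp add: fourier_translate sum_distrib_right mult.assoc)
      also have "\<dots> = 0" using zero[of \<chi>] by (auto simp: supp_def)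
      finally show ?thesis .
    qed
    \<comment> \<open>Injectivity carries the vanishing of the transform back to the combination of
      translates itself.\<close>
    from fourier_eq_0_imp_eq_0[OF prim this] ind c show False by blast
  qed
  then have "card B * card (supp F) \<le> card (supp F) * card (supp (fourier F))"
    by (simp add: mult.commute)
  with B show ?thesis by linarith
qed

theorem mainTheorem12:
  fixes \<iota> :: "'f::field \<Rightarrow> 'e::field"
    and f :: "'g::{ab_group_add,finite} \<Rightarrow> 'f"
    and fhat :: "('g, 'e) character \<Rightarrow> 'e"
  assumes char: "CHAR('f) = 0 \<or> \<not> CHAR('f) dvd card (UNIV :: 'g set)"
    and ext: "field_embedding \<iota>"
    and root: "\<exists>\<zeta>::'e. primitive_root_of_unity (group_exponent TYPE('g)) \<zeta>"
    and nonzero: "f \<noteq> (\<lambda>_. 0)"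
    and fhat: "fhat = fourier (\<lambda>x. \<iota> (f x))"
  shows "int (card (supp f)) * int (card (supp fhat))
           \<ge> int (card (UNIV :: 'g set)) + int (card (supp fhat)) - int (card (stabilizer (supp fhat)))
       \<and> int (card (supp f)) * int (card (supp fhat))
           \<ge> int (card (UNIV :: 'g set)) + int (card (supp f)) - int (card (stabilizer (supp f)))"
proof -
  obtain \<zeta> :: 'e where prim: "primitive_root_of_unity (group_exponent TYPE('g)) \<zeta>"
    using root by blast
  have \<iota>: "\<iota> 1 = 1" "\<And>x y. \<iota> (x + y) = \<iota> x + \<iota> y" "\<And>x y. \<iota> (x * y) = \<iota> x * \<iota> y"
    using ext by (auto simp: field_embedding_def)
  have "\<iota> 0 = 0" using \<iota>(2)[of 0 0] by (metis add_0 add_cancel_right_right)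
  moreover have "\<iota> x \<noteq> 0" if "x \<noteq> 0" for x
    using \<iota>(3)[of x "inverse x"] \<iota>(1) that by auto
  ultimately have \<iota>_0: "\<iota> x = 0 \<longleftrightarrow> x = 0" for x by blast
  \<comment> \<open>An embedding preserves the support, so the bounds proved over \<open>'e\<close>
    speak about \<open>f\<close> itself.\<close>
  then have supp: "supp (\<lambda>x. \<iota> (f x)) = supp f" by (simp add: supp_def)
  obtain y where "f y \<noteq> 0" using nonzero by blast
  then have "\<iota> (f y) \<noteq> 0" by (simp add: \<iota>_0)
  from uncertainty_stabilizer_fourier[OF prim, of "\<lambda>x. \<iota> (f x)", OF this]
    uncertainty_stabilizer[OF prim, of "\<lambda>x. \<iota> (f x)", OF this]
  show ?thesis
    unfolding supp fhat[symmetric] by (simp flip: of_nat_mult of_nat_add)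
qed

end
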